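(* Let $\mathcal{G}_{[n;k_1,\dots,k_n]}$ be the vector space of finite games with $n$ players in which player $i$ has $k_i$ strategies, let $k=\prod_{i=1}^n k_i$, and identify $\mathcal{G}_{[n;k_1,\dots,k_n]}$ with $\mathbb{R}^{nk}$ via payoff (row) vectors $V_G$. Let $Q\in\mathbb{R}^{nk\times nk}$ be a (symmetric) positive definite matrix, and consider a decomposition $$\mathcal{G}_{[n;k_1,\dots,k_n]}=\mathcal{M}_1\oplus\mathcal{M}_2\oplus\cdots\oplus\mathcal{M}_p,$$ where each $\mathcal{M}_i$ is a subspace of the space of finite games. This common decomposition can be induced by the standard inner product $\langle\cdot,\cdot\rangle$ and the weighted inner product $\langle\cdot,\cdot\rangle_Q$ simultaneously if and only if the compatible condition is satisfied, i.e. there are distinct indices $i_1,\dots,i_{p-1}\in\{1,\dots,p\}$ such that, for every $j=1,\dots,p-1$ and every game $G\in\mathcal{M}_{i_j}$ with payoff vector $V_G$, the games determined by the payoff vectors $V_GQ$ and $V_GQ^{-1}$ also belong to $\mathcal{M}_{i_j}$.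
   Context: A finite non-cooperative game is a triple $G=\{N,S,c\}$ with player set $N=\{1,\dots,n\}$, strategy profile set $S=\prod_{i=1}^n S_i$, where $S_i=\{1,\dots,k_i\}$ is the strategy set of player $i$, and payoff functions $c=\{c_1,\dots,c_n\}$, $c_i:S\to\mathbb{R}$. $\mathcal{G}_{[n;k_1,\dots,k_n]}$ is the set of all such games for fixed $n,k_1,\dots,k_n$. Put $k=\prod_{i=1}^n k_i$. For each player $i$, the structure vector $V_i\in\mathbb{R}^k$ is the row vector listing the values $c_i(s)$, $s\in S$, with the profiles $s$ in lexicographic order (equivalently, identifying strategy $j\in S_i$ with the $j$-th column of the identity matrix $I_{k_i}$, one has $c_i(s_1,\dots,s_n)=V_i\,(s_1\otimes\cdots\otimes s_n)$). The payoff vector of $G$ is the row vector $V_G=[V_1,\dots,V_n]\in\mathbb{R}^{nk}$. The map $G\mapsto V_G$ identifies $\mathcal{G}_{[n;k_1,\dots,k_n]}$ with the vector space $\mathbb{R}^{nk}$, so every vector in $\mathbb{R}^{nk}$ determines a game. For row vectors $X,Y\in\mathbb{R}^{nk}$, the standard inner product is $\langle X,Y\rangle=XY^{T}$, and, for a positive definite matrix $Q\in\mathbb{R}^{nk\times nk}$, the weighted inner product with weight matrix $Q$ is $\langle X,Y\rangle_Q=XQY^{T}$. A decomposition $\mathcal{G}_{[n;k_1,\dots,k_n]}=\mathcal{M}_1\oplus\cdots\oplus\mathcal{M}_p$ is said to be induced by an inner product if it is orthogonal with respect to that inner product, i.e. for all $a\neq b$, all $G\in\mathcal{M}_a$ and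 all $G'\in\mathcal{M}_b$, the inner product of $V_G$ and $V_{G'}$ is $0$.
   Formalization: The decomposition is additionally assumed to be induced by at least one of the two inner products; without this the "if" direction fails (e.g. Q = I with a non-orthogonal decomposition). *)

theory Defs
  imports
    "HOL-Library.Function_Algebras"
    "HOL-Library.FuncSet"
    "Jordan_Normal_Form.Determinant"
begin

section \<open>Finite games\<close>

text \<open>A game with $n$ players is given by the list ks = $[k_1,\dots,k_n]$ of the numbers of
  strategies and by the payoff functions $c_i$ for $i \in \{1,\dots,n\}$. A strategy profile is a
  list of length $n$ whose entries are counted from 1. Outside the players and profiles of the game,
  payoffs are fixed to be 0, so that distinct members of finite_games are distinct games.\<close>

type_synonym game = "nat \<Rightarrow> nat list \<Rightarrow> real"

definition profiles :: "nat list \<Rightarrow> nat list set" where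
  "profiles ks = {s. length s = length ks \<and> (\<forall>i<length ks. s ! i \<in> {1..ks ! i})}"

definition finite_games :: "nat list \<Rightarrow> game set" where
  "finite_games ks = {c. \<forall>i s. \<not> (i \<in> {1..length ks} \<and> s \<in> profiles ks) \<longrightarrow> c i s = 0}"

text \<open>Addition and zero of games are the pointwise ones of HOL-Library.Function_Algebras.\<close>

definition scale_game :: "real \<Rightarrow> game \<Rightarrow> game" where
  "scale_game r c = (\<lambda>i s. r * c i s)"

global_interpretation game: vector_space scale_game
  by unfold_locales (auto simp: scale_game_def fun_eq_iff algebra_simps)


section \<open>Payoff vectors\<close>

text \<open>The function product_lists enumerates in lexicographic order.\<close>

definition lex_profiles :: "nat list \<Rightarrow> nat list list" where
  "lex_profiles ks = product_lists (map (\<lambda>m. [1..<Suc m]) ks)"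

definition structure_list :: "nat list \<Rightarrow> game \<Rightarrow> nat \<Rightarrow> real list" where
  "structure_list ks c i = map (c i) (lex_profiles ks)"

definition payoff_vec :: "nat list \<Rightarrow> game \<Rightarrow> real vec" where
  "payoff_vec ks c = vec_of_list (concat (map (structure_list ks c) [1..<Suc (length ks)]))"

definition game_of_vec :: "nat list \<Rightarrow> real vec \<Rightarrow> game" where
  "game_of_vec ks = the_inv_into (finite_games ks) (payoff_vec ks)"

lemma set_lex_profiles: "set (lex_profiles ks) = profiles ks"
  unfolding lex_profiles_def profiles_def product_lists_set
  by (auto simp: list_all2_conv_all_nth less_Suc_eq_le simp del: upt_Suc)

lemma length_lex_profiles: "length (lex_profiles ks) = prod_list ks"
proof -
  have "foldr (\<lambda>x. (*) (length x)) (map (\<lambda>m. [1..<Suc m]) ks) 1 = prod_list ks"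
    by (induction ks) auto
  then show ?thesis
    by (induction ks) (auto simp: lex_profiles_def length_concat comp_def sum_list_triv)
qed

lemma distinct_lex_profiles: "distinct (lex_profiles ks)"
proof (induction ks)
  case (Cons k ks)
  let ?f = "\<lambda>x. map ((#) x) (lex_profiles ks)"
  have "distinct (concat (map ?f xs))" if "distinct xs" for xs
    using that Cons by (induction xs) (auto simp: distinct_map)
  then show ?case
    by (simp add: lex_profiles_def del: upt_Suc)
qed (simp add: lex_profiles_def)

lemma length_payoff_list:
  "length (concat (map (structure_list ks c) [1..<Suc n])) = n * prod_list ks"
  by (induction n) (simp_all add: structure_list_def length_lex_profiles)

lemma payoff_vec_carrier: "payoff_vec ks c \<in> carrier_vec (length ks * prod_list ks)"
  unfolding payoff_vec_def carrier_vec_def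
  by (simp only: mem_Collect_eq dim_vec_of_list length_payoff_list)

lemma inj_on_payoff_vec: "inj_on (payoff_vec ks) (finite_games ks)"
proof (rule inj_onI)
  fix c d assume c: "c \<in> finite_games ks" and d: "d \<in> finite_games ks"
    and eq: "payoff_vec ks c = payoff_vec ks d"
  let ?is = "[1..<Suc (length ks)]"
  have "concat (map (structure_list ks c) ?is) = concat (map (structure_list ks d) ?is)"
    using eq unfolding payoff_vec_def by (metis list_vec)
  then have "map (structure_list ks c) ?is = map (structure_list ks d) ?is"
    by (rule concat_injective) (auto simp: structure_list_def set_zip simp del: upt_Suc)
  then have "\<forall>i\<in>{1..length ks}. \<forall>s\<in>profiles ks. c i s = d i s"
    by (auto simp: structure_list_def set_lex_profiles[symmetric] less_Suc_eq_le simp del: upt_Suc)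
  with c d show "c = d"
    unfolding finite_games_def by (intro ext) (metis (mono_tags, lifting) mem_Collect_eq)
qed

lemma concat_blocks:
  "concat (map (\<lambda>i. map (\<lambda>j. f ((i - 1) * k + j)) [0..<k]) [1..<Suc n]) = map f [0..<n * k]"
  for f :: "nat \<Rightarrow> 'a"
proof (induction n)
  case (Suc n)
  have "[0..<Suc n * k] = [0..<n * k] @ map (\<lambda>j. n * k + j) [0..<k]"
    by (intro nth_equalityI) (auto simp: nth_append)
  with Suc show ?case by simp
qed simp

lemma payoff_vec_surj:
  assumes v: "v \<in> carrier_vec (length ks * prod_list ks)"
  shows "v \<in> payoff_vec ks ` finite_games ks"
proof
  let ?L = "lex_profiles ks" and ?k = "prod_list ks" and ?n = "length ks"
  define ix where "ix s = (THE j. j < ?k \<and> ?L ! j = s)" for s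
  define c where "c i s = (if i \<in> {1..?n} \<and> s \<in> profiles ks then v $ ((i - 1) * ?k + ix s) else 0)"
    for i s
  show "c \<in> finite_games ks" by (auto simp: finite_games_def c_def)
  have ix: "ix (?L ! j) = j" if "j < ?k" for j
    unfolding ix_def using that distinct_lex_profiles[of ks]
    by (intro the_equality) (auto simp: nth_eq_iff_index_eq length_lex_profiles)
  have "structure_list ks c i = map (\<lambda>j. v $ ((i - 1) * ?k + j)) [0..<?k]"
    if "i \<in> {1..?n}" for i
  proof (rule nth_equalityI)
    fix j assume "j < length (structure_list ks c i)"
    then have j: "j < ?k" by (simp add: structure_list_def length_lex_profiles)
    then have "?L ! j \<in> profiles ks"
      using nth_mem[of j ?L] by (simp add: set_lex_profiles length_lex_profiles)
    with that j show "structure_list ks c i ! j = map (\<lambda>j. v $ ((i - 1) * ?k + j)) [0..<?k] ! j"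
      by (simp add: structure_list_def length_lex_profiles c_def ix)
  qed (simp add: structure_list_def length_lex_profiles)
  then have "map (structure_list ks c) [1..<Suc ?n]
      = map (\<lambda>i. map (\<lambda>j. v $ ((i - 1) * ?k + j)) [0..<?k]) [1..<Suc ?n]"
    by (intro map_cong) (auto simp del: upt_Suc)
  then have "payoff_vec ks c = vec_of_list (map (($) v) [0..<?n * ?k])"
    unfolding payoff_vec_def by (simp only: concat_blocks)
  also have "\<dots> = v" using v by (intro eq_vecI) (auto simp: vec_of_list_index)
  finally show "v = payoff_vec ks c" ..
qed

lemma bij_betw_payoff_vec:
  "bij_betw (payoff_vec ks) (finite_games ks) (carrier_vec (length ks * prod_list ks))"
  unfolding bij_betw_def using inj_on_payoff_vec payoff_vec_carrier payoff_vec_surj by blast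


section \<open>Inner products\<close>

definition row_mult :: "real vec \<Rightarrow> real mat \<Rightarrow> real vec" where
  "row_mult x A = vec (dim_col A) (\<lambda>j. x \<bullet> col A j)"

definition weighted_inner :: "real mat \<Rightarrow> real vec \<Rightarrow> real vec \<Rightarrow> real" where
  "weighted_inner Q x y = row_mult x Q \<bullet> y"

definition sym_pos_def :: "nat \<Rightarrow> real mat \<Rightarrow> bool" where
  "sym_pos_def m Q \<longleftrightarrow> Q \<in> carrier_mat m m \<and> transpose_mat Q = Q \<and>
     (\<forall>x\<in>carrier_vec m. x \<noteq> 0\<^sub>v m \<longrightarrow> x \<bullet> (Q *\<^sub>v x) > 0)"

lemma mat_inverse_sym_pos_def:
  assumes "sym_pos_def m Q"
  shows "the (mat_inverse Q) \<in> carrier_mat m m"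
    and "Q * the (mat_inverse Q) = 1\<^sub>m m" and "the (mat_inverse Q) * Q = 1\<^sub>m m"
proof -
  have Q: "Q \<in> carrier_mat m m" using assms by (simp add: sym_pos_def_def)
  have "det Q \<noteq> 0"
  proof
    assume "det Q = 0"
    then obtain x where "x \<in> carrier_vec m" "x \<noteq> 0\<^sub>v m" "Q *\<^sub>v x = 0\<^sub>v m"
      using det_0_iff_vec_prod_zero[OF Q] by blast
    with assms show False unfolding sym_pos_def_def by force
  qed
  then have "Q \<in> Units (ring_mat TYPE(real) m ())" by (rule det_non_zero_imp_unit[OF Q])
  then obtain B where "mat_inverse Q = Some B" using mat_inverse(1)[OF Q, where b = "()"] by auto
  with mat_inverse(2)[OF Q] show "the (mat_inverse Q) \<in> carrier_mat m m"
    "Q * the (mat_inverse Q) = 1\<^sub>m m" "the (mat_inverse Q) * Q = 1\<^sub>m m" by auto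
qed


section \<open>Decompositions\<close>

definition game_decomposition :: "nat list \<Rightarrow> nat \<Rightarrow> (nat \<Rightarrow> game set) \<Rightarrow> bool" where
  "game_decomposition ks p M \<longleftrightarrow>
     (\<forall>a\<in>{1..p}. M a \<subseteq> finite_games ks \<and> game.subspace (M a)) \<and>
     (\<forall>G\<in>finite_games ks. \<exists>!g. g \<in> (\<Pi>\<^sub>E a\<in>{1..p}. M a) \<and> G = (\<Sum>a\<in>{1..p}. g a))"

definition induced_by ::
  "(real vec \<Rightarrow> real vec \<Rightarrow> real) \<Rightarrow> nat list \<Rightarrow> nat \<Rightarrow> (nat \<Rightarrow> game set) \<Rightarrow> bool" where
  "induced_by ip ks p M \<longleftrightarrow>
     (\<forall>a\<in>{1..p}. \<forall>b\<in>{1..p}. a \<noteq> b \<longrightarrow>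
        (\<forall>G\<in>M a. \<forall>G'\<in>M b. ip (payoff_vec ks G) (payoff_vec ks G') = 0))"

definition compatible :: "real mat \<Rightarrow> nat list \<Rightarrow> nat \<Rightarrow> (nat \<Rightarrow> game set) \<Rightarrow> bool" where
  "compatible Q ks p M \<longleftrightarrow>
     (\<exists>idx. inj_on idx {1..p - 1} \<and> idx ` {1..p - 1} \<subseteq> {1..p} \<and>
        (\<forall>j\<in>{1..p - 1}. \<forall>G\<in>M (idx j).
           game_of_vec ks (row_mult (payoff_vec ks G) Q) \<in> M (idx j) \<and>
           game_of_vec ks (row_mult (payoff_vec ks G) (the (mat_inverse Q))) \<in> M (idx j)))"

end

theory Submission
  imports Defs
begin

text \<open>Both inner products are of the form \<^term>\<open>weighted_inner W\<close> with $W$ symmetric positive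
  definite (the standard one is $W = I$), and they determine one another:
  $\langle xQ, y\rangle = \langle x, y\rangle_Q$ and
  $\langle xQ^{-1}, y\rangle_Q = \langle x, y\rangle$.

  If both inner products induce the decomposition and $x \in M_a$, then $xQ$ is orthogonal to every
  other summand in the standard inner product, and $xQ^{-1}$ is so in the weighted one. In an
  orthogonal decomposition with respect to a definite inner product, the vectors orthogonal to all
  summands but $M_a$ are those of $M_a$ (\<open>mem_summand_if_orthogonal\<close>), so every
  summand, and in particular any choice of $p-1$ of them, is invariant under $Q$ and $Q^{-1}$.

  Conversely, let one of the two inner products induce the decomposition. Of two distinct summands
  at least one is among the $p-1$ invariant ones. By symmetry of the inner products it may be taken
  to be the first one, $M_a$ (\<open>induced_byI_family\<close>), and then the two displayed
  identities carry the orthogonality of $M_a$ and $M_b$ from either inner product to the other.\<close>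

section \<open>Weighted inner products\<close>

lemma row_mult_eq_transpose:
  "A \<in> carrier_mat m n \<Longrightarrow> x \<in> carrier_vec m \<Longrightarrow> row_mult x A = transpose_mat A *\<^sub>v x"
  by (intro eq_vecI) (auto simp: row_mult_def intro!: comm_scalar_prod[of _ m])

lemma row_mult_carrier: "A \<in> carrier_mat m n \<Longrightarrow> row_mult x A \<in> carrier_vec n"
  by (auto simp: row_mult_def)

lemma row_mult_assoc:
  assumes "A \<in> carrier_mat m n" "B \<in> carrier_mat n l" "x \<in> carrier_vec m"
  shows "row_mult (row_mult x A) B = row_mult x (A * B)"
  using assms
  by (simp add: row_mult_eq_transpose[of A m n] row_mult_eq_transpose[of B n l]
      row_mult_eq_transpose[of "A * B" m l] transpose_mult[of A m n B l]
      assoc_mult_mat_vec[of _ l n _ m])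

lemma row_mult_one: "x \<in> carrier_vec m \<Longrightarrow> row_mult x (1\<^sub>m m) = x"
  by (simp add: row_mult_eq_transpose[of _ m m])

lemma sym_pos_def_one: "sym_pos_def m (1\<^sub>m m)"
proof -
  have "x \<bullet> x > 0" if "x \<in> carrier_vec m" "x \<noteq> 0\<^sub>v m" for x :: "real vec"
  proof -
    have "conjugate x = x"
      by (intro eq_vecI) auto
    with that show ?thesis
      using conjugate_square_greater_0_vec[OF that(1)] by simp
  qed
  then show ?thesis
    by (simp add: sym_pos_def_def)
qed

lemma weighted_inner_one: "x \<in> carrier_vec m \<Longrightarrow> weighted_inner (1\<^sub>m m) x y = x \<bullet> y"
  by (simp add: weighted_inner_def row_mult_one)

lemma row_mult_sym_pos_def:
  "sym_pos_def m Q \<Longrightarrow> x \<in> carrier_vec m \<Longrightarrow> row_mult x Q = Q *\<^sub>v x"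
  by (simp add: sym_pos_def_def row_mult_eq_transpose[of _ m m])

lemma weighted_inner_commute:
  assumes "sym_pos_def m Q" "x \<in> carrier_vec m" "y \<in> carrier_vec m"
  shows "weighted_inner Q x y = weighted_inner Q y x"
proof -
  have Q: "Q \<in> carrier_mat m m" "transpose_mat Q = Q"
    using assms(1) by (auto simp: sym_pos_def_def)
  have "(Q *\<^sub>v x) \<bullet> y = x \<bullet> (Q *\<^sub>v y)"
    using transpose_vec_mult_scalar[OF Q(1) assms(3,2)] Q assms
    by (metis comm_scalar_prod mult_mat_vec_carrier)
  also have "\<dots> = (Q *\<^sub>v y) \<bullet> x"
    using Q assms by (metis comm_scalar_prod mult_mat_vec_carrier)
  finally show ?thesis
    using assms by (simp add: weighted_inner_def row_mult_sym_pos_def)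
qed

lemma weighted_inner_self_eq_0:
  assumes "sym_pos_def m Q" "x \<in> carrier_vec m" "weighted_inner Q x x = 0"
  shows "x = 0\<^sub>v m"
proof (rule ccontr)
  assume "x \<noteq> 0\<^sub>v m"
  then have "x \<bullet> (Q *\<^sub>v x) > 0"
    using assms by (auto simp: sym_pos_def_def)
  moreover have "x \<bullet> (Q *\<^sub>v x) = weighted_inner Q x x"
  proof -
    have "Q *\<^sub>v x \<in> carrier_vec m"
      using assms by (auto simp: sym_pos_def_def)
    then show ?thesis
      using comm_scalar_prod[OF assms(2)]
      by (simp add: weighted_inner_def row_mult_sym_pos_def[OF assms(1,2)])
  qed
  ultimately show False
    using assms(3) by simp
qed

lemma weighted_inner_row_mult_inverse:
  assumes "sym_pos_def m Q" "x \<in> carrier_vec m"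
  shows "weighted_inner Q (row_mult x (the (mat_inverse Q))) y = x \<bullet> y"
  using assms mat_inverse_sym_pos_def[OF assms(1)]
  by (simp add: weighted_inner_def row_mult_assoc[of _ m m _ m] row_mult_one sym_pos_def_def)


section \<open>Linearity of the payoff vector\<close>

text \<open>Here the list of pairs does not depend on the game, so that linearity can be read off
  entry by entry.\<close>

lemma payoff_vec_product:
  "payoff_vec ks c
    = vec_of_list (map (\<lambda>(i, s). c i s) (List.product [1..<Suc (length ks)] (lex_profiles ks)))"
  by (simp add: payoff_vec_def product_concat_map structure_list_def[abs_def] map_concat comp_def
      del: upt_Suc)

lemma payoff_vec_add: "payoff_vec ks (c + d) = payoff_vec ks c + payoff_vec ks d"
  unfolding payoff_vec_product
  by (intro eq_vecI) (auto simp: vec_of_list_index case_prod_unfold simp del: upt_Suc)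

lemma payoff_vec_zero: "payoff_vec ks 0 = 0\<^sub>v (length ks * prod_list ks)"
proof -
  have "payoff_vec ks 0 = payoff_vec ks 0 - payoff_vec ks (0 + 0)"
    by (intro eq_vecI) (auto simp: payoff_vec_product vec_of_list_index case_prod_unfold
        simp del: upt_Suc)
  then show ?thesis
    using minus_cancel_vec[OF payoff_vec_carrier] by simp
qed

lemma weighted_inner_payoff_sum:
  assumes Q: "sym_pos_def (length ks * prod_list ks) Q"
    and y: "y \<in> carrier_vec (length ks * prod_list ks)" and "finite A"
  shows "weighted_inner Q (payoff_vec ks (\<Sum>a\<in>A. g a)) y
    = (\<Sum>a\<in>A. weighted_inner Q (payoff_vec ks (g a)) y)"
  using \<open>finite A\<close>
proof induction
  case empty
  have "Q *\<^sub>v 0\<^sub>v (length ks * prod_list ks) = 0\<^sub>v (length ks * prod_list ks)"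
    using Q by (auto simp: sym_pos_def_def intro!: eq_vecI)
  then have "weighted_inner Q (payoff_vec ks 0) y = 0"
    using Q y by (simp only: weighted_inner_def payoff_vec_zero row_mult_sym_pos_def
        zero_carrier_vec scalar_prod_left_zero)
  then show ?case
    by (simp only: sum.empty)
next
  case (insert a A)
  let ?m = "length ks * prod_list ks"
  have QC: "Q \<in> carrier_mat ?m ?m"
    using Q by (simp add: sym_pos_def_def)
  have "weighted_inner Q (u + v) y = weighted_inner Q u y + weighted_inner Q v y"
    if "u \<in> carrier_vec ?m" "v \<in> carrier_vec ?m" for u v
    using Q QC y that
    by (simp add: weighted_inner_def row_mult_sym_pos_def mult_add_distrib_mat_vec[of _ ?m ?m]
        add_scalar_prod_distrib[of _ ?m])
  with insert show ?case
    by (simp only: sum.insert[OF insert.hyps] payoff_vec_add payoff_vec_carrier)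
qed

lemma game_of_vec:
  assumes "v \<in> carrier_vec (length ks * prod_list ks)"
  shows "game_of_vec ks v \<in> finite_games ks" "payoff_vec ks (game_of_vec ks v) = v"
  unfolding game_of_vec_def
  using the_inv_into_into[OF inj_on_payoff_vec payoff_vec_surj[OF assms] order_refl]
    f_the_inv_into_f[OF inj_on_payoff_vec payoff_vec_surj[OF assms]] by auto


section \<open>Orthogonal decompositions\<close>

text \<open>In the decomposition of $G$, the component in $M_b$ with $b \<noteq> a$ has the same inner product
  with itself as with $G$, which is 0. Definiteness makes it vanish, leaving the component in
  $M_a$.\<close>

lemma mem_summand_if_orthogonal:
  assumes W: "sym_pos_def (length ks * prod_list ks) W"
    and dec: "game_decomposition ks p M" and ind: "induced_by (weighted_inner W) ks p M"
    and G: "G \<in> finite_games ks" and a: "a \<in> {1..p}"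
    and orth: "\<And>b H. b \<in> {1..p} \<Longrightarrow> b \<noteq> a \<Longrightarrow> H \<in> M b
      \<Longrightarrow> weighted_inner W (payoff_vec ks G) (payoff_vec ks H) = 0"
  shows "G \<in> M a"
proof -
  obtain g where g: "g \<in> (\<Pi>\<^sub>E a\<in>{1..p}. M a)" and Gsum: "G = (\<Sum>a\<in>{1..p}. g a)"
    using dec G unfolding game_decomposition_def by blast
  have gM: "g b \<in> M b" if "b \<in> {1..p}" for b
    using g that by blast
  have "g b = 0" if b: "b \<in> {1..p}" "b \<noteq> a" for b
  proof -
    let ?ip = "\<lambda>c. weighted_inner W (payoff_vec ks (g c)) (payoff_vec ks (g b))"
    have "0 = weighted_inner W (payoff_vec ks G) (payoff_vec ks (g b))"
      using orth[OF b gM[OF b(1)]] by simp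
    also have "\<dots> = (\<Sum>c\<in>{1..p}. ?ip c)"
      unfolding Gsum by (rule weighted_inner_payoff_sum[OF W payoff_vec_carrier]) simp
    also have "\<dots> = (\<Sum>c\<in>{1..p}. if c = b then ?ip b else 0)"
      using ind b gM unfolding induced_by_def by (intro sum.cong) auto
    also have "\<dots> = ?ip b"
      using b by simp
    finally have "payoff_vec ks (g b) = payoff_vec ks 0"
      using weighted_inner_self_eq_0[OF W payoff_vec_carrier] by (simp add: payoff_vec_zero)
    moreover have "g b \<in> finite_games ks"
      using dec gM b unfolding game_decomposition_def by blast
    moreover have "0 \<in> finite_games ks"
      by (simp add: finite_games_def)
    ultimately show "g b = 0"
      using inj_onD[OF inj_on_payoff_vec] by blast
  qed
  then have "G = (\<Sum>c\<in>{1..p}. if c = a then g a else 0)"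
    unfolding Gsum by (intro sum.cong) auto
  also have "\<dots> = g a"
    using a by simp
  finally show ?thesis
    using gM[OF a] by simp
qed

lemma induced_by_weighted_inner_one:
  "induced_by (weighted_inner (1\<^sub>m (length ks * prod_list ks))) ks p M
    \<longleftrightarrow> induced_by scalar_prod ks p M"
  by (simp add: induced_by_def weighted_inner_one[OF payoff_vec_carrier])

lemma summands_invariant:
  assumes Q: "sym_pos_def (length ks * prod_list ks) Q"
    and dec: "game_decomposition ks p M"
    and std: "induced_by scalar_prod ks p M" and wgt: "induced_by (weighted_inner Q) ks p M"
    and a: "a \<in> {1..p}" and G: "G \<in> M a"
  shows "game_of_vec ks (row_mult (payoff_vec ks G) Q) \<in> M a"
    and "game_of_vec ks (row_mult (payoff_vec ks G) (the (mat_inverse Q))) \<in> M a"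
proof -
  let ?m = "length ks * prod_list ks" and ?x = "payoff_vec ks G"
  have "Q \<in> carrier_mat ?m ?m"
    using Q by (simp add: sym_pos_def_def)
  then have xQ: "row_mult ?x Q \<in> carrier_vec ?m"
    by (rule row_mult_carrier)
  show "game_of_vec ks (row_mult ?x Q) \<in> M a"
  proof (rule mem_summand_if_orthogonal[OF sym_pos_def_one dec _ game_of_vec(1)[OF xQ] a])
    show "induced_by (weighted_inner (1\<^sub>m ?m)) ks p M"
      using std by (simp add: induced_by_weighted_inner_one)
    fix b H assume "b \<in> {1..p}" "b \<noteq> a" "H \<in> M b"
    then have "weighted_inner Q ?x (payoff_vec ks H) = 0"
      using wgt a G by (auto simp: induced_by_def)
    then show "weighted_inner (1\<^sub>m ?m) (payoff_vec ks (game_of_vec ks (row_mult ?x Q)))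
        (payoff_vec ks H) = 0"
      by (simp add: game_of_vec(2)[OF xQ] weighted_inner_one[OF xQ]) (simp add: weighted_inner_def)
  qed
  have xQ': "row_mult ?x (the (mat_inverse Q)) \<in> carrier_vec ?m"
    using mat_inverse_sym_pos_def(1)[OF Q] by (rule row_mult_carrier)
  show "game_of_vec ks (row_mult ?x (the (mat_inverse Q))) \<in> M a"
  proof (rule mem_summand_if_orthogonal[OF Q dec wgt game_of_vec(1)[OF xQ'] a])
    fix b H assume "b \<in> {1..p}" "b \<noteq> a" "H \<in> M b"
    then have "?x \<bullet> payoff_vec ks H = 0"
      using std a G by (auto simp: induced_by_def)
    then show "weighted_inner Q (payoff_vec ks (game_of_vec ks
        (row_mult ?x (the (mat_inverse Q))))) (payoff_vec ks H) = 0"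
      by (simp add: game_of_vec(2)[OF xQ']
          weighted_inner_row_mult_inverse[OF Q payoff_vec_carrier])
  qed
qed

text \<open>Two distinct indices cannot both lie outside \<open>I\<close>, which omits at most one index, and
  symmetry allows the one in \<open>I\<close> to come first. This is why invariance of $p-1$ summands
  suffices.\<close>

lemma induced_byI_family:
  assumes sym: "\<And>x y. x \<in> carrier_vec (length ks * prod_list ks)
      \<Longrightarrow> y \<in> carrier_vec (length ks * prod_list ks) \<Longrightarrow> ip x y = ip y x"
    and I: "I \<subseteq> {1..p}" "card I = p - 1"
    and orth: "\<And>a b G H. a \<in> I \<Longrightarrow> b \<in> {1..p} \<Longrightarrow> a \<noteq> b \<Longrightarrow> G \<in> M a \<Longrightarrow> H \<in> M b
      \<Longrightarrow> ip (payoff_vec ks G) (payoff_vec ks H) = 0"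
  shows "induced_by ip ks p M"
  unfolding induced_by_def
proof (intro ballI impI)
  fix a b G H assume a: "a \<in> {1..p}" and b: "b \<in> {1..p}" and "a \<noteq> b" "G \<in> M a" "H \<in> M b"
  have "a \<in> I \<or> b \<in> I"
  proof (rule ccontr)
    assume "\<not> (a \<in> I \<or> b \<in> I)"
    then have "card {a, b} \<le> card ({1..p} - I)"
      using a b by (intro card_mono) auto
    also have "\<dots> = p - (p - 1)"
      using I by (subst card_Diff_subset) (auto intro: finite_subset)
    finally show False
      using \<open>a \<noteq> b\<close> by simp
  qed
  then show "ip (payoff_vec ks G) (payoff_vec ks H) = 0"
    using orth a b \<open>a \<noteq> b\<close> \<open>G \<in> M a\<close> \<open>H \<in> M b\<close>
      sym[OF payoff_vec_carrier payoff_vec_carrier] by metis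
qed

theorem mainTheorem1:
  fixes ks :: "nat list" and p :: nat and M :: "nat \<Rightarrow> game set" and Q :: "real mat"
  assumes "length ks \<ge> 1" and "\<forall>k\<in>set ks. k \<ge> 1"
    and "sym_pos_def (length ks * prod_list ks) Q"
    and "p \<ge> 1" and "game_decomposition ks p M"
    and "induced_by scalar_prod ks p M \<or> induced_by (weighted_inner Q) ks p M"
  shows "induced_by scalar_prod ks p M \<and> induced_by (weighted_inner Q) ks p M
     \<longleftrightarrow> compatible Q ks p M"
proof
  assume "induced_by scalar_prod ks p M \<and> induced_by (weighted_inner Q) ks p M"
  then have "game_of_vec ks (row_mult (payoff_vec ks G) Q) \<in> M (id j) \<and>
      game_of_vec ks (row_mult (payoff_vec ks G) (the (mat_inverse Q))) \<in> M (id j)"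
    if "j \<in> {1..p - 1}" "G \<in> M (id j)" for j G
    using summands_invariant[OF assms(3,5), of j G] that by auto
  then show "compatible Q ks p M"
    unfolding compatible_def by (intro exI[of _ id]) auto
next
  let ?m = "length ks * prod_list ks"
  note Q = assms(3)
  assume "compatible Q ks p M"
  then obtain idx where inj: "inj_on idx {1..p - 1}" and sub: "idx ` {1..p - 1} \<subseteq> {1..p}"
    and inv: "\<And>j G. j \<in> {1..p - 1} \<Longrightarrow> G \<in> M (idx j) \<Longrightarrow>
         game_of_vec ks (row_mult (payoff_vec ks G) Q) \<in> M (idx j) \<and>
         game_of_vec ks (row_mult (payoff_vec ks G) (the (mat_inverse Q))) \<in> M (idx j)"
    unfolding compatible_def by blast
  let ?I = "idx ` {1..p - 1}"
  have card: "card ?I = p - 1"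
    using inj by (simp add: card_image)
  have Q_car: "Q \<in> carrier_mat ?m ?m"
    using Q by (simp add: sym_pos_def_def)
  note family = induced_byI_family[OF _ sub card]
  have "induced_by (weighted_inner Q) ks p M" if std: "induced_by scalar_prod ks p M"
  proof (rule family[OF weighted_inner_commute[OF Q]])
    fix a b G H assume *: "a \<in> ?I" "b \<in> {1..p}" "a \<noteq> b" "G \<in> M a" "H \<in> M b"
    let ?xQ = "row_mult (payoff_vec ks G) Q"
    have "game_of_vec ks ?xQ \<in> M a"
      using inv * by blast
    then have "payoff_vec ks (game_of_vec ks ?xQ) \<bullet> payoff_vec ks H = 0"
      using std * sub unfolding induced_by_def by blast
    then show "weighted_inner Q (payoff_vec ks G) (payoff_vec ks H) = 0"
      by (simp add: weighted_inner_def game_of_vec(2)[OF row_mult_carrier[OF Q_car]])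
  qed
  moreover have "induced_by scalar_prod ks p M" if wgt: "induced_by (weighted_inner Q) ks p M"
  proof (rule family[OF comm_scalar_prod])
    fix a b G H assume *: "a \<in> ?I" "b \<in> {1..p}" "a \<noteq> b" "G \<in> M a" "H \<in> M b"
    let ?xQ' = "row_mult (payoff_vec ks G) (the (mat_inverse Q))"
    have "game_of_vec ks ?xQ' \<in> M a"
      using inv * by blast
    then have "weighted_inner Q (payoff_vec ks (game_of_vec ks ?xQ')) (payoff_vec ks H) = 0"
      using wgt * sub unfolding induced_by_def by blast
    then show "payoff_vec ks G \<bullet> payoff_vec ks H = 0"
      by (simp add: weighted_inner_row_mult_inverse[OF Q payoff_vec_carrier]
          game_of_vec(2)[OF row_mult_carrier[OF mat_inverse_sym_pos_def(1)[OF Q]]])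
  qed
  ultimately show "induced_by scalar_prod ks p M \<and> induced_by (weighted_inner Q) ks p M"
    using assms(6) by blast
qed

end
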